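(* Let $\mathbb X$ be a nonempty finite set of points of the projective space $\mathbb P^{s-1}$ over a field $K$. Then $\delta_{\mathbb X}(d,H_{\mathbb X}(d))=|\mathbb X|$ for all $d\ge1$.
   Context: Let $S=K[t_1,\dots,t_s]=\bigoplus_{d\ge 0}S_d$ with the standard grading, $\mathbb X=\{P_1,\dots,P_n\}$ with each $P_i$ represented by the coordinate vector whose first nonzero coordinate is $1$, and $I(\mathbb X)$ the ideal generated by the homogeneous polynomials vanishing on $\mathbb X$. $H_{\mathbb X}(d)=\dim_K(S_d/I(\mathbb X)_d)$. The projective Reed–Muller-type code $C_{\mathbb X}(d)$ is the image of the linear map $S_d\to K^n$, $f\mapsto(f(P_1),\dots,f(P_n))$; its dimension is $H_{\mathbb X}(d)$. For a linear code $C\subset K^n$ and a linear subspace $D\subset C$, the support is $\chi(D)=\{i : \exists (x_1,\dots,x_n)\in D,\ x_i\ne0\}$, and for $1\le r\le\dim C$ the $r$-th generalized Hamming weight is $\delta_r(C)=\min\{|\chi(D)| : D\subset C,\ \dim D=r\}$. Put $\delta_{\mathbb X}(d,r)=\delta_r(C_{\mathbb X}(d))$. *)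

theory Defs
  imports "HOL-Library.Poly_Mapping" "HOL-Algebra.QuotRing" "Jordan_Normal_Form.VS_Connect"
begin

text \<open>
  The coefficient field \<open>K\<close> is a type \<open>'k :: field\<close>, viewed as a ring structure through
  \<^const>\<open>class_ring\<close>; \<open>K\<^sup>n\<close> is \<^term>\<open>module_vec TYPE('k::field) n\<close>.
  Variables, coordinates and points are all numbered from \<open>0\<close>.
\<close>

subsection \<open>The graded polynomial ring in \<open>s\<close> variables\<close>

text \<open>A monomial is its exponent vector, a polynomial the finitely supported map of its
  coefficients.  The type has countably many variables; \<open>S\<close> consists of the polynomials in the
  first \<open>s\<close> of them.\<close>

type_synonym 'k mpoly = "(nat \<Rightarrow>\<^sub>0 nat) \<Rightarrow>\<^sub>0 'k"

definition poly_ring :: "nat \<Rightarrow> 'k::field mpoly ring" where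
  "poly_ring s =
     \<lparr>carrier = {f. \<forall>m\<in>Poly_Mapping.keys f. Poly_Mapping.keys m \<subseteq> {..<s}},
      mult = (*), one = 1, zero = 0, add = (+)\<rparr>"

definition monom_degree :: "(nat \<Rightarrow>\<^sub>0 nat) \<Rightarrow> nat" where
  "monom_degree m = (\<Sum>i\<in>Poly_Mapping.keys m. Poly_Mapping.lookup m i)"

text \<open>The graded piece \<open>S\<^sub>d\<close> (containing \<open>0\<close>).\<close>

definition forms :: "nat \<Rightarrow> nat \<Rightarrow> 'k::field mpoly set" where
  "forms s d = {f \<in> carrier (poly_ring s). \<forall>m\<in>Poly_Mapping.keys f. monom_degree m = d}"

definition forms_module :: "nat \<Rightarrow> nat \<Rightarrow> ('k::field, 'k mpoly) module" where
  "forms_module s d =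
     \<lparr>carrier = forms s d, mult = undefined, one = undefined, zero = 0, add = (+),
      smult = (\<lambda>c f. Poly_Mapping.single 0 c * f)\<rparr>"

definition poly_eval :: "'k::field mpoly \<Rightarrow> 'k vec \<Rightarrow> 'k" where
  "poly_eval f v =
     (\<Sum>m\<in>Poly_Mapping.keys f.
        Poly_Mapping.lookup f m * (\<Prod>i\<in>Poly_Mapping.keys m. v $ i ^ Poly_Mapping.lookup m i))"

subsection \<open>Quotient modules\<close>

text \<open>In the scalar multiplication all the cosets \<open>W + c a\<close> with \<open>a \<in> A\<close> coincide, so that the
  union is again a single coset (the plain image of \<open>A\<close> would be wrong for \<open>c = 0\<close>).\<close>

definition quot_module :: "('a, 'b) module \<Rightarrow> 'b set \<Rightarrow> ('a, 'b set) module" where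
  "quot_module M W =
     \<lparr>carrier = a_rcosets\<^bsub>M\<^esub> W, mult = undefined, one = undefined, zero = W,
      add = set_add M, smult = (\<lambda>c A. \<Union>a\<in>A. W +>\<^bsub>M\<^esub> (c \<odot>\<^bsub>M\<^esub> a))\<rparr>"

subsection \<open>Points of projective space\<close>

text \<open>A point of \<open>P\<^sup>s\<^sup>-\<^sup>1\<close> is the set of all its coordinate vectors.\<close>

definition proj_point :: "'k::field vec \<Rightarrow> 'k vec set" where
  "proj_point v = {c \<cdot>\<^sub>v v | c. c \<noteq> 0}"

definition proj_space :: "nat \<Rightarrow> 'k::field vec set set" where
  "proj_space s = proj_point ` (carrier_vec s - {0\<^sub>v s})"

definition std_rep :: "'k::field vec set \<Rightarrow> 'k vec" where
  "std_rep P = (THE v. v \<in> P \<and> (\<exists>j<dim_vec v. v $ j = 1 \<and> (\<forall>i<j. v $ i = 0)))"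

subsection \<open>Vanishing ideal and Hilbert function\<close>

definition vanishing_ideal :: "nat \<Rightarrow> 'k::field vec set set \<Rightarrow> 'k mpoly set" where
  "vanishing_ideal s X =
     Idl\<^bsub>poly_ring s\<^esub> {f. (\<exists>e. f \<in> forms s e) \<and> (\<forall>P\<in>X. poly_eval f (std_rep P) = 0)}"

definition hilbert_function :: "nat \<Rightarrow> 'k::field vec set set \<Rightarrow> nat \<Rightarrow> nat" where
  "hilbert_function s X d =
     vectorspace.dim class_ring
       (quot_module (forms_module s d) (vanishing_ideal s X \<inter> forms s d))"

subsection \<open>Codes and generalized Hamming weights\<close>

definition support :: "'k::field vec set \<Rightarrow> nat set" where
  "support D = {i. \<exists>x\<in>D. i < dim_vec x \<and> x $ i \<noteq> 0}"

text \<open>For a linear code \<open>C\<close> of length \<open>n\<close> and \<open>1 \<le> r \<le> dim C\<close> the infimum is a minimum; otherwise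
  the value carries no meaning (it is \<open>0\<close>).\<close>

definition gen_hamming_weight :: "nat \<Rightarrow> 'k::field vec set \<Rightarrow> nat \<Rightarrow> nat" where
  "gen_hamming_weight n C r =
     Inf {card (support D) | D.
            VectorSpace.subspace class_ring D (module_vec TYPE('k) n) \<and> D \<subseteq> C \<and>
            vectorspace.dim class_ring ((module_vec TYPE('k) n)\<lparr>carrier := D\<rparr>) = r}"

text \<open>The points are given as a list \<open>[P\<^sub>1, \<dots>, P\<^sub>n]\<close>, whose order fixes that of the coordinates.\<close>

definition reed_muller_code :: "nat \<Rightarrow> 'k::field vec set list \<Rightarrow> nat \<Rightarrow> 'k vec set" where
  "reed_muller_code s Ps d =
     (\<lambda>f. vec (length Ps) (\<lambda>i. poly_eval f (std_rep (Ps ! i)))) ` forms s d"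

definition rm_weight :: "nat \<Rightarrow> 'k::field vec set list \<Rightarrow> nat \<Rightarrow> nat \<Rightarrow> nat" where
  "rm_weight s Ps d r = gen_hamming_weight (length Ps) (reed_muller_code s Ps d) r"

end

theory Submission
  imports Defs
begin

text \<open>
  A form of degree \<open>d\<close> lies in the vanishing ideal iff it vanishes at every point, so the degree
  \<open>d\<close> part of the ideal is the kernel of the evaluation map, and by the first isomorphism theorem
  the Hilbert function at \<open>d\<close> is the dimension of the code \<open>C\<close>.  The only subspace of \<open>C\<close> of that
  dimension is \<open>C\<close> itself, and its support contains every coordinate: at a point whose \<open>j\<close>-th
  coordinate is \<open>1\<close> the form \<open>t\<^sub>j\<^sup>d\<close> does not vanish.
\<close>

section \<open>Evaluation of polynomials\<close>

definition monom_eval :: "'k::field vec \<Rightarrow> (nat \<Rightarrow>\<^sub>0 nat) \<Rightarrow> 'k" where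
  "monom_eval v m = (\<Prod>i\<in>Poly_Mapping.keys m. v $ i ^ Poly_Mapping.lookup m i)"

text \<open>Exponents outside the keys are 0 and contribute factors 1. This lets two monomials be
  compared over a common index set.\<close>

lemma monom_eval_superset:
  assumes "finite A" "Poly_Mapping.keys m \<subseteq> A"
  shows "monom_eval v m = (\<Prod>i\<in>A. v $ i ^ Poly_Mapping.lookup m i)"
  unfolding monom_eval_def
  by (rule prod.mono_neutral_left) (use assms in \<open>auto simp: in_keys_iff\<close>)

lemma monom_eval_add: "monom_eval v (m + m') = monom_eval v m * monom_eval v m'"
proof -
  let ?A = "Poly_Mapping.keys m \<union> Poly_Mapping.keys m'"
  have "monom_eval v (m + m') = (\<Prod>i\<in>?A. v $ i ^ Poly_Mapping.lookup (m + m') i)"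
    by (rule monom_eval_superset) (simp_all add: keys_add)
  also have "\<dots> = (\<Prod>i\<in>?A. v $ i ^ Poly_Mapping.lookup m i) * (\<Prod>i\<in>?A. v $ i ^ Poly_Mapping.lookup m' i)"
    by (simp add: lookup_add power_add prod.distrib)
  also have "\<dots> = monom_eval v m * monom_eval v m'"
    by (simp add: monom_eval_superset[of ?A])
  finally show ?thesis .
qed

lemma poly_eval_eq:
  "poly_eval f v = (\<Sum>m\<in>Poly_Mapping.keys f. Poly_Mapping.lookup f m * monom_eval v m)"
  by (simp add: poly_eval_def monom_eval_def)

lemma poly_eval_zero [simp]: "poly_eval 0 v = 0"
  by (simp add: poly_eval_def)

lemma poly_eval_add: "poly_eval (f + g) v = poly_eval f v + poly_eval g v"
  \<comment> \<open>Keys may cancel in \<open>f + g\<close>; the sum still splits because each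
    summand is additive in the coefficient and is 0 at coefficient 0.\<close>
  unfolding poly_eval_eq
  by (rule setsum_keys_plus_distrib) (simp_all add: distrib_right)

lemma poly_eval_single: "poly_eval (Poly_Mapping.single m c) v = c * monom_eval v m"
  by (simp add: poly_eval_eq)

text \<open>Phrased with addition instead of \<open>update\<close>, so that the induction step
  matches distributivity and \<open>poly_eval_add\<close>.\<close>

lemma poly_mapping_single_add_induct:
  fixes P :: "('a \<Rightarrow>\<^sub>0 'b::monoid_add) \<Rightarrow> bool"
  assumes "P 0" "\<And>f m c. P f \<Longrightarrow> P (Poly_Mapping.single m c + f)"
  shows "P f"
proof (induction f rule: update_induct)
  case (update f a b)
  \<comment> \<open>The key \<open>a\<close> is new, so \<open>f\<close> has coefficient 0 there and
    overwriting amounts to adding.\<close>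
  have "Poly_Mapping.update a b f = Poly_Mapping.single a b + f"
    using update(1)
    by (intro poly_mapping_eqI)
      (auto simp: lookup_update lookup_add lookup_single when_def in_keys_iff)
  then show ?case using assms(2)[OF update(3)] by simp
qed (fact assms(1))

text \<open>Both sides are biadditive, so induction on each factor reduces the claim to two single
  terms, where it is \<open>monom_eval_add\<close>.\<close>

lemma poly_eval_mult: "poly_eval (f * g) v = poly_eval f v * poly_eval g v"
proof (induction f rule: poly_mapping_single_add_induct)
  case (2 f m c)
  have "poly_eval (Poly_Mapping.single m c * g) v = poly_eval (Poly_Mapping.single m c) v * poly_eval g v"
  proof (induction g rule: poly_mapping_single_add_induct)
    case (2 g m' c')
    then show ?case
      by (simp add: distrib_left poly_eval_add mult_single poly_eval_single monom_eval_add)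
  qed simp
  then show ?case using 2 by (simp add: distrib_right poly_eval_add)
qed simp

lemma poly_eval_const_mult: "poly_eval (Poly_Mapping.single 0 c * f) v = c * poly_eval f v"
  by (simp add: poly_eval_mult poly_eval_single monom_eval_def)

lemma poly_eval_uminus: "poly_eval (- f) v = - poly_eval f v"
  using poly_eval_add[of f "- f" v] by (simp add: eq_neg_iff_add_eq_0 add.commute)

section \<open>The vanishing ideal in degree \<open>d\<close>\<close>

lemma poly_ring_simps [simp]:
  "add (poly_ring s) = (+)" "mult (poly_ring s) = (*)"
  "zero (poly_ring s) = 0" "one (poly_ring s) = 1"
  by (simp_all add: poly_ring_def)

lemma carrier_poly_ring:
  "f \<in> carrier (poly_ring s) \<longleftrightarrow> (\<forall>m\<in>Poly_Mapping.keys f. Poly_Mapping.keys m \<subseteq> {..<s})"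
  by (simp add: poly_ring_def)

lemma carrier_poly_ring_add:
  "f \<in> carrier (poly_ring s) \<Longrightarrow> g \<in> carrier (poly_ring s) \<Longrightarrow> f + g \<in> carrier (poly_ring s)"
  unfolding carrier_poly_ring using keys_add[of f g] by blast

lemma carrier_poly_ring_mult:
  assumes "f \<in> carrier (poly_ring s)" "g \<in> carrier (poly_ring s)"
  shows "f * g \<in> carrier (poly_ring s)"
  unfolding carrier_poly_ring
proof
  fix m assume "m \<in> Poly_Mapping.keys (f * g)"
  then obtain a b where "m = a + b" "a \<in> Poly_Mapping.keys f" "b \<in> Poly_Mapping.keys g"
    using keys_mult[of f g] by blast
  then show "Poly_Mapping.keys m \<subseteq> {..<s}"
    using assms keys_add[of a b] unfolding carrier_poly_ring by blast
qed

lemma carrier_poly_ring_uminus: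
  "f \<in> carrier (poly_ring s) \<Longrightarrow> - f \<in> carrier (poly_ring s)"
  by (simp add: carrier_poly_ring)

lemma zero_one_in_poly_ring [simp]: "0 \<in> carrier (poly_ring s)" "1 \<in> carrier (poly_ring s)"
  by (simp_all add: carrier_poly_ring)

lemma ring_poly_ring: "ring (poly_ring s :: 'k::field mpoly ring)"
proof (rule ringI)
  show "abelian_group (poly_ring s :: 'k mpoly ring)"
  proof (rule abelian_groupI)
    fix f :: "'k mpoly" assume "f \<in> carrier (poly_ring s)"
    then show "\<exists>g\<in>carrier (poly_ring s). g \<oplus>\<^bsub>poly_ring s\<^esub> f = \<zero>\<^bsub>poly_ring s\<^esub>"
      by (intro bexI[of _ "- f"]) (simp_all add: carrier_poly_ring_uminus)
  qed (simp_all add: carrier_poly_ring_add ac_simps)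
  show "Group.monoid (poly_ring s :: 'k mpoly ring)"
    by (rule monoidI) (simp_all add: carrier_poly_ring_mult ac_simps)
qed (simp_all add: algebra_simps)

text \<open>Evaluation respects sums and products. With \<open>V\<close> the standard
  representatives, this ideal contains all generators of the vanishing ideal and so bounds it from
  above.\<close>

lemma vanishing_polynomials_ideal:
  fixes V :: "'k::field vec set"
  shows "ideal {f \<in> carrier (poly_ring s). \<forall>v\<in>V. poly_eval f v = 0} (poly_ring s)"
    (is "ideal ?J _")
proof (rule idealI[OF ring_poly_ring])
  interpret ring "poly_ring s :: 'k mpoly ring" by (rule ring_poly_ring)
  show "subgroup ?J (add_monoid (poly_ring s))"
  proof (rule add.subgroupI)
    have "0 \<in> ?J" by simp
    then show "?J \<noteq> {}" by blast
    fix f assume f: "f \<in> ?J"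
    have "\<ominus>\<^bsub>poly_ring s\<^esub> f = - f"
      using f by (intro minus_equality) (auto simp: carrier_poly_ring_uminus)
    then show "\<ominus>\<^bsub>poly_ring s\<^esub> f \<in> ?J"
      using f by (simp add: carrier_poly_ring_uminus poly_eval_uminus)
  qed (auto simp: carrier_poly_ring_add poly_eval_add)
qed (auto simp: carrier_poly_ring_mult poly_eval_mult)

lemma vanishing_ideal_inter_forms:
  "vanishing_ideal s X \<inter> forms s d
    = {f \<in> forms s d. \<forall>P\<in>X. poly_eval f (std_rep P) = 0}" (is "?L = ?R")
proof
  let ?J = "{f \<in> carrier (poly_ring s). \<forall>v\<in>std_rep ` X. poly_eval f v = 0}"
  have "vanishing_ideal s X \<subseteq> ?J"
    unfolding vanishing_ideal_def
    by (rule ring.genideal_minimal[OF ring_poly_ring vanishing_polynomials_ideal])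
      (auto simp: forms_def)
  then show "?L \<subseteq> ?R" by auto
  \<comment> \<open>Such a form is itself one of the generators.\<close>
  show "?R \<subseteq> ?L"
    unfolding vanishing_ideal_def genideal_def by blast
qed

section \<open>Linear algebra\<close>

text \<open>The vector space axioms are transported along the surjection \<open>g\<close>, so
  \<open>Q\<close> need only carry compatible operations. This is how the quotient becomes a vector
  space.\<close>

lemma linear_map_onto_criteria:
  assumes "vectorspace K V" and surj: "g ` carrier V = carrier Q"
    and zero: "g \<zero>\<^bsub>V\<^esub> = \<zero>\<^bsub>Q\<^esub>"
    and add: "\<And>x y. x \<in> carrier V \<Longrightarrow> y \<in> carrier V \<Longrightarrow> g (x \<oplus>\<^bsub>V\<^esub> y) = g x \<oplus>\<^bsub>Q\<^esub> g y"
    and smult: "\<And>c x. c \<in> carrier K \<Longrightarrow> x \<in> carrier V \<Longrightarrow> g (c \<odot>\<^bsub>V\<^esub> x) = c \<odot>\<^bsub>Q\<^esub> g x"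
  shows "linear_map K V Q g"
proof -
  interpret V: vectorspace K V by fact
  have closed: "g x \<in> carrier Q" if "x \<in> carrier V" for x
    using that surj by blast
  have "vectorspace K Q"
  proof (rule vs_criteria)
    show "field K" ..
    show "\<forall>v\<in>carrier Q. \<exists>neg_v\<in>carrier Q. v \<oplus>\<^bsub>Q\<^esub> neg_v = \<zero>\<^bsub>Q\<^esub>"
    proof
      fix v assume "v \<in> carrier Q"
      then obtain x where x: "x \<in> carrier V" "v = g x" using surj by blast
      then have "v \<oplus>\<^bsub>Q\<^esub> g (\<ominus>\<^bsub>V\<^esub> x) = \<zero>\<^bsub>Q\<^esub>"
        using add[of x "\<ominus>\<^bsub>V\<^esub> x"] zero by (simp add: V.M.r_neg)
      moreover have "g (\<ominus>\<^bsub>V\<^esub> x) \<in> carrier Q" using x(1) closed by simp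
      ultimately show "\<exists>neg_v\<in>carrier Q. v \<oplus>\<^bsub>Q\<^esub> neg_v = \<zero>\<^bsub>Q\<^esub>" by blast
    qed
  \<comment> \<open>Every element of \<open>Q\<close> is some \<open>g x\<close>; rewriting the
    operations of \<open>Q\<close> backwards turns each axiom into the image of one in
    \<open>V\<close>.\<close>
  qed (auto simp: surj[symmetric] zero[symmetric] add[symmetric] smult[symmetric]
      V.M.a_ac V.smult_assoc1 V.smult_l_distr V.smult_r_distr)
  show ?thesis
  proof (intro linear_map.intro mod_hom.intro mod_hom_axioms.intro)
    show "g \<in> LinearCombinations.module_hom K V Q"
      using closed add smult by (simp add: LinearCombinations.module_hom_def)
  qed (use \<open>vectorspace K Q\<close> assms(1) in \<open>simp_all add: vectorspace_def\<close>)
qed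

section \<open>Subspaces of a finite-dimensional space\<close>

context vectorspace
begin

text \<open>Independent subsets of \<open>W\<close> have at most \<open>dim\<close> elements, so a
  maximal one exists, and it generates \<open>W\<close>.\<close>

lemma subspace_fin_dim:
  assumes fd: "fin_dim" and W: "subspace K W V"
  shows "vectorspace.fin_dim K (vs W)"
proof -
  interpret W: vectorspace K "vs W" by (rule subspace_is_vs[OF W])
  have sub: "submodule K W V" using W by simp
  then have WV: "W \<subseteq> carrier V" by (simp add: submodule_def)
  let ?P = "\<lambda>A. A \<subseteq> W \<and> lin_indpt A"
  have "\<exists>A. finite A \<and> maximal A ?P"
  proof (rule maximal_exists)
    show "finite A \<and> card A \<le> dim" if "?P A" for A
      using that li_le_dim[OF fd] WV by auto
    show "?P {}" by (simp add: lin_dep_def)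
  qed
  then obtain A where A: "finite A" "maximal A ?P" by blast
  \<comment> \<open>Linear independence of a subset of \<open>W\<close> means the same in
    \<open>W\<close> as in \<open>V\<close>, so maximality carries over.\<close>
  then have "maximal A (\<lambda>S. S \<subseteq> carrier (vs W) \<and> W.lin_indpt S)"
    using span_li_not_depend(2)[OF _ sub] by (auto simp: maximal_def)
  then have "W.gen_set A" by (rule W.max_li_is_gen)
  moreover have "A \<subseteq> W" using A by (auto simp: maximal_def)
  ultimately show ?thesis using A(1) unfolding W.fin_dim_def by auto
qed

text \<open>A basis of \<open>D\<close> stays independent in \<open>C\<close> and has as many
  elements as the dimension of \<open>C\<close>, so it spans both.\<close>

lemma subspace_eqI_dim:
  assumes fd: "fin_dim" and D: "subspace K D V" and C: "subspace K C V" and DC: "D \<subseteq> C"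
    and dim: "vectorspace.dim K (vs D) = vectorspace.dim K (vs C)"
  shows "D = C"
proof -
  interpret D: vectorspace K "vs D" by (rule subspace_is_vs[OF D])
  interpret C: vectorspace K "vs C" by (rule subspace_is_vs[OF C])
  have subD: "submodule K D V" and subC: "submodule K C V" using C D by simp_all
  obtain B where B: "finite B" "D.basis B"
    using D.finite_basis_exists[OF subspace_fin_dim[OF fd D]] by blast
  have BD: "B \<subseteq> D" and gen: "D.span B = D" and li: "D.lin_indpt B"
    using B unfolding D.basis_def by auto
  have BC: "B \<subseteq> C" using BD DC by blast
  have "C.basis B"
  proof (rule C.dim_li_is_basis[OF subspace_fin_dim[OF fd C] B(1)])
    show "C.lin_indpt B"
      using li span_li_not_depend(2)[OF BD subD] span_li_not_depend(2)[OF BC subC] by simp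
    show "C.dim \<le> card B" using D.dim_basis[OF B] dim by simp
  qed (use BC in simp)
  then have "C.span B = C" unfolding C.basis_def by auto
  then show ?thesis
    using gen span_li_not_depend(1)[OF BD subD] span_li_not_depend(1)[OF BC subC] by simp
qed

end

section \<open>First isomorphism theorem for the coset space of the kernel\<close>

text \<open>\<^const>\<open>quot_module\<close> accepts no record extensions, hence the type constraint.\<close>

locale kernel_quotient = linear_map K V W T
  for K and V :: "('a, 'c) module" and W and T
begin

text \<open>On \<open>imT\<close> this is the inverse of the isomorphism from \<open>V\<close>
  modulo the kernel to the image. Going in this direction avoids choosing coset
  representatives.\<close>

definition fibre where
  "fibre w = {v \<in> carrier V. T v = w}"

lemma fibre_iff: "v \<in> fibre w \<longleftrightarrow> v \<in> carrier V \<and> T v = w"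
  by (simp add: fibre_def)

lemma ker_coset_eq_fibre:
  assumes x: "x \<in> carrier V"
  shows "kerT +>\<^bsub>V\<^esub> x = fibre (T x)"
proof (intro equalityI subsetI)
  fix y assume "y \<in> kerT +>\<^bsub>V\<^esub> x"
  then obtain k where "k \<in> carrier V" "T k = \<zero>\<^bsub>W\<^esub>" "y = k \<oplus>\<^bsub>V\<^esub> x"
    by (auto simp: a_r_coset_def' ker_def)
  then show "y \<in> fibre (T x)" using x by (simp add: fibre_iff)
next
  fix y assume y: "y \<in> fibre (T x)"
  let ?k = "y \<ominus>\<^bsub>V\<^esub> x"
  have "?k \<in> kerT"
    using x y by (simp add: ker_def fibre_iff W.module.M.minus_eq W.module.M.r_neg)
  moreover have "y = ?k \<oplus>\<^bsub>V\<^esub> x"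
    using x y by (simp add: fibre_iff V.module.M.minus_eq V.module.M.a_assoc V.module.M.l_neg)
  ultimately show "y \<in> kerT +>\<^bsub>V\<^esub> x" by (auto simp: a_r_coset_def')
qed

text \<open>Outside \<open>imT\<close> fibres are empty, while the fibre of a sum may be nonempty;
  hence the restriction to the image.\<close>

lemma fibre_add:
  assumes v: "v \<in> imT" and w: "w \<in> imT"
  shows "fibre (v \<oplus>\<^bsub>W\<^esub> w) = fibre v <+>\<^bsub>V\<^esub> fibre w"
proof (intro equalityI subsetI)
  fix z assume z: "z \<in> fibre (v \<oplus>\<^bsub>W\<^esub> w)"
  obtain x where x: "x \<in> carrier V" "T x = v" using v by (auto simp: im_def)
  have wW: "w \<in> carrier W" using w by (auto simp: im_def)
  \<comment> \<open>With \<open>x\<close> a fixed preimage of \<open>v\<close>, the element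
    \<open>z\<close> splits as \<open>x\<close> plus the difference of \<open>z\<close> and
    \<open>x\<close>.\<close>
  have "z \<ominus>\<^bsub>V\<^esub> x \<in> fibre w"
    using x z wW by (auto simp: fibre_iff W.module.M.minus_eq W.module.M.a_ac W.module.M.r_neg1
        W.module.M.r_neg W.module.M.l_neg)
  moreover have "z = x \<oplus>\<^bsub>V\<^esub> (z \<ominus>\<^bsub>V\<^esub> x)"
    using x z V.module.M.a_comm[of z "\<ominus>\<^bsub>V\<^esub> x"]
    by (simp add: fibre_iff V.module.M.minus_eq V.module.M.r_neg2)
  moreover have "x \<in> fibre v" using x by (simp add: fibre_iff)
  ultimately show "z \<in> fibre v <+>\<^bsub>V\<^esub> fibre w"
    unfolding set_add_def' by blast
qed (auto simp: set_add_def' fibre_iff)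

lemma fibre_smult:
  assumes c: "c \<in> carrier K" and w: "w \<in> imT"
  shows "fibre (c \<odot>\<^bsub>W\<^esub> w) = (\<Union>a\<in>fibre w. kerT +>\<^bsub>V\<^esub> (c \<odot>\<^bsub>V\<^esub> a))"
proof -
  have "kerT +>\<^bsub>V\<^esub> (c \<odot>\<^bsub>V\<^esub> a) = fibre (c \<odot>\<^bsub>W\<^esub> w)" if "a \<in> fibre w" for a
    using that c by (subst ker_coset_eq_fibre) (auto simp: fibre_iff)
  \<comment> \<open>Nonemptiness makes the union of equal cosets that coset rather than the empty
    set.\<close>
  moreover have "fibre w \<noteq> {}" using w by (auto simp: im_def fibre_def)
  ultimately show ?thesis by auto
qed

lemma quot_ker_linear_map:
  "linear_map K (W.vs imT) (quot_module V kerT) fibre"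
proof (rule linear_map_onto_criteria)
  show "vectorspace K (W.vs imT)" by (rule W.subspace_is_vs[OF imT_is_subspace])
  show "fibre ` carrier (W.vs imT) = carrier (quot_module V kerT)"
    by (auto simp: quot_module_def A_RCOSETS_def' im_def ker_coset_eq_fibre)
  show "fibre \<zero>\<^bsub>W.vs imT\<^esub> = \<zero>\<^bsub>quot_module V kerT\<^esub>"
    by (simp add: quot_module_def fibre_def ker_def)
qed (simp_all add: quot_module_def fibre_add fibre_smult)

text \<open>\<open>fibre\<close> is a linear bijection from the image onto the quotient. Finiteness
  is asked of the target: the image inherits it as a subspace of \<open>W\<close>.\<close>

lemma dim_quot_ker:
  assumes "W.fin_dim"
  shows "vectorspace.dim K (quot_module V kerT) = vectorspace.dim K (W.vs imT)"
proof -
  interpret F: linear_map K "W.vs imT" "quot_module V kerT" fibre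
    by (rule quot_ker_linear_map)
  show ?thesis
  proof (rule F.dim_eq[symmetric])
    show "F.V.fin_dim" by (rule W.subspace_fin_dim[OF assms imT_is_subspace])
    \<comment> \<open>Over an image point the fibre is nonempty, and any of its elements determines
      the point through \<open>T\<close>.\<close>
    show "inj_on fibre (carrier (W.vs imT))"
      by (auto simp: inj_on_def im_def fibre_def)
    show "fibre ` carrier (W.vs imT) = carrier (quot_module V kerT)"
      by (auto simp: quot_module_def A_RCOSETS_def' im_def ker_coset_eq_fibre)
  qed
qed

end

section \<open>The code as the image of the evaluation map\<close>

definition evaluation :: "'k::field vec set list \<Rightarrow> 'k mpoly \<Rightarrow> 'k vec" where
  "evaluation Ps f = vec (length Ps) (\<lambda>i. poly_eval f (std_rep (Ps ! i)))"

lemma forms_module_simps [simp]: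
  "carrier (forms_module s d) = forms s d" "add (forms_module s d) = (+)"
  "zero (forms_module s d) = 0"
  "Module.module.smult (forms_module s d) c f = Poly_Mapping.single 0 c * f"
  by (simp_all add: forms_module_def)

lemma forms_iff:
  "f \<in> forms s d \<longleftrightarrow>
    (\<forall>m\<in>Poly_Mapping.keys f. Poly_Mapping.keys m \<subseteq> {..<s} \<and> monom_degree m = d)"
  by (auto simp: forms_def carrier_poly_ring)

lemma forms_add: "f \<in> forms s d \<Longrightarrow> g \<in> forms s d \<Longrightarrow> f + g \<in> forms s d"
  unfolding forms_iff using keys_add[of f g] by blast

lemma forms_const_mult: "f \<in> forms s d \<Longrightarrow> Poly_Mapping.single 0 c * f \<in> forms s d"
  unfolding forms_iff using keys_mult[of "Poly_Mapping.single 0 c" f] by (fastforce split: if_splits)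

lemma vectorspace_forms: "vectorspace class_ring (forms_module s d :: ('k::field, 'k mpoly) module)"
proof (rule vs_criteria)
  show "\<forall>f\<in>carrier (forms_module s d). \<exists>g\<in>carrier (forms_module s d).
      f \<oplus>\<^bsub>forms_module s d\<^esub> g = \<zero>\<^bsub>forms_module s d :: ('k, 'k mpoly) module\<^esub>"
    by (intro ballI bexI[of _ "- _"]) (auto simp: forms_iff)
  \<comment> \<open>Scalars act as constant polynomials, so associativity of the action needs the
    embedding of constants to be multiplicative.\<close>
  have "Poly_Mapping.single 0 (a * b) = Poly_Mapping.single 0 a * (Poly_Mapping.single 0 b :: 'k mpoly)"
    for a b :: 'k
    by (simp add: mult_single)
  then show "\<forall>a b f. a \<in> carrier class_ring \<and> b \<in> carrier class_ring \<and> f \<in> carrier (forms_module s d) \<longrightarrow>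
      (a \<otimes>\<^bsub>class_ring\<^esub> b) \<odot>\<^bsub>forms_module s d\<^esub> f
        = a \<odot>\<^bsub>forms_module s d\<^esub> (b \<odot>\<^bsub>forms_module s d :: ('k, 'k mpoly) module\<^esub> f)"
    by (simp add: mult.assoc)
  show "\<zero>\<^bsub>forms_module s d :: ('k, 'k mpoly) module\<^esub> \<in> carrier (forms_module s d)"
    by (simp add: forms_iff)
qed (simp_all add: class_field forms_add forms_const_mult distrib_left distrib_right add_ac single_add)

lemma linear_map_evaluation:
  fixes Ps :: "'k::field vec set list"
  shows "linear_map class_ring (forms_module s d) (module_vec TYPE('k) (length Ps)) (evaluation Ps)"
proof -
  have V: "vectorspace class_ring (forms_module s d :: ('k, 'k mpoly) module)"
    by (rule vectorspace_forms)
  show ?thesis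
  proof (intro linear_map.intro mod_hom.intro mod_hom_axioms.intro)
    show "evaluation Ps \<in> LinearCombinations.module_hom class_ring
        (forms_module s d) (module_vec TYPE('k) (length Ps))"
      by (auto simp: LinearCombinations.module_hom_def evaluation_def module_vec_simps
          poly_eval_add poly_eval_const_mult)
  qed (use V vec_vs[where 'a='k] in \<open>simp_all add: vectorspace_def\<close>)
qed

lemma reed_muller_code_eq: "reed_muller_code s Ps d = evaluation Ps ` forms s d"
  by (simp add: reed_muller_code_def evaluation_def)

lemma subspace_reed_muller_code:
  fixes Ps :: "'k::field vec set list"
  shows "VectorSpace.subspace class_ring (reed_muller_code s Ps d) (module_vec TYPE('k) (length Ps))"
proof -
  interpret linear_map class_ring "forms_module s d" "module_vec TYPE('k) (length Ps)" "evaluation Ps"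
    by (rule linear_map_evaluation)
  show ?thesis using imT_is_subspace by (simp add: im_def reed_muller_code_eq)
qed

lemma hilbert_function_eq_dim_code:
  fixes Ps :: "'k::field vec set list"
  shows "hilbert_function s (set Ps) d = vectorspace.dim class_ring
    ((module_vec TYPE('k) (length Ps))\<lparr>carrier := reed_muller_code s Ps d\<rparr>)"
proof -
  interpret kernel_quotient class_ring "forms_module s d" "module_vec TYPE('k) (length Ps)" "evaluation Ps"
    unfolding kernel_quotient_def by (rule linear_map_evaluation)
  interpret vec_space "TYPE('k)" "length Ps" .
  \<comment> \<open>The evaluation vector is 0 iff all its coordinates are, that is, iff the form
    vanishes at every listed point.\<close>
  have "kerT = vanishing_ideal s (set Ps) \<inter> forms s d"
    unfolding vanishing_ideal_inter_forms
    by (auto simp: ker_def evaluation_def module_vec_simps vec_eq_iff all_set_conv_all_nth)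
  moreover have "imT = reed_muller_code s Ps d"
    by (simp add: im_def reed_muller_code_eq)
  ultimately show ?thesis
    using dim_quot_ker[OF fin_dim] by (simp add: hilbert_function_def)
qed

section \<open>Standard representatives and the support of the code\<close>

lemma std_rep_coordinate_one:
  assumes "P \<in> proj_space s"
  obtains j where "j < s" "std_rep P $ j = 1"
proof -
  obtain v where v: "v \<in> carrier_vec s" "v \<noteq> 0\<^sub>v s" "P = proj_point v"
    using assms by (auto simp: proj_space_def)
  then have ex: "\<exists>j. j < s \<and> v $ j \<noteq> 0" by (auto simp: vec_eq_iff)
  \<comment> \<open>The first nonzero coordinate of \<open>v\<close>; dividing by it gives the
    standard representative.\<close>
  define j where "j = (LEAST j. j < s \<and> v $ j \<noteq> 0)"
  have j: "j < s" "v $ j \<noteq> 0" using LeastI_ex[OF ex] by (auto simp: j_def)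
  have less: "v $ i = 0" if "i < j" for i
    using that not_less_Least[of i "\<lambda>j. j < s \<and> v $ j \<noteq> 0"] j(1) by (auto simp: j_def)
  have "std_rep P = inverse (v $ j) \<cdot>\<^sub>v v"
    unfolding std_rep_def
  proof (rule the_equality)
    show "inverse (v $ j) \<cdot>\<^sub>v v \<in> P \<and> (\<exists>ja<dim_vec (inverse (v $ j) \<cdot>\<^sub>v v).
        (inverse (v $ j) \<cdot>\<^sub>v v) $ ja = 1 \<and> (\<forall>i<ja. (inverse (v $ j) \<cdot>\<^sub>v v) $ i = 0))"
      using v j less by (auto simp: proj_point_def intro!: exI[of _ j])
  next
    fix w assume w: "w \<in> P \<and> (\<exists>j<dim_vec w. w $ j = 1 \<and> (\<forall>i<j. w $ i = 0))"
    then obtain c k where c: "c \<noteq> 0" "w = c \<cdot>\<^sub>v v"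
      and k: "k < s" "w $ k = 1" "\<forall>i<k. w $ i = 0"
      using v by (auto simp: proj_point_def)
    \<comment> \<open>Scaling by a nonzero \<open>c\<close> does not move the first nonzero
      coordinate. This gives the uniqueness that \<open>THE\<close> requires.\<close>
    have "k = j"
    proof (rule linorder_cases[of k j])
      assume "k < j" then show ?thesis using less k c v by auto
    next
      assume "j < k" then show ?thesis using j k c v by auto
    qed
    then have "c * v $ j = 1" using k c v by auto
    then have "c = inverse (v $ j)" by (metis inverse_unique mult.commute)
    then show "w = inverse (v $ j) \<cdot>\<^sub>v v" using c by simp
  qed
  then have "std_rep P $ j = 1" using j v by simp
  then show ?thesis using that j by blast
qed

lemma support_reed_muller_code:
  assumes "set Ps \<subseteq> proj_space s"
  shows "support (reed_muller_code s Ps d) = {..<length Ps}"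
proof (intro equalityI subsetI)
  fix i assume i: "i \<in> {..<length Ps}"
  then have "Ps ! i \<in> proj_space s" using assms by auto
  then obtain j where j: "j < s" "std_rep (Ps ! i) $ j = 1" by (rule std_rep_coordinate_one)
  \<comment> \<open>The power of a variable whose coordinate at the \<open>i\<close>-th point is 1;
    the choice of \<open>j\<close> depends on the point.\<close>
  define f :: "'a mpoly" where "f = Poly_Mapping.single (Poly_Mapping.single j d) 1"
  have "f \<in> forms s d" using j by (auto simp: f_def forms_iff monom_degree_def)
  moreover have "evaluation Ps f $ i = 1"
    using i j by (simp add: evaluation_def f_def poly_eval_single monom_eval_def)
  ultimately show "i \<in> support (reed_muller_code s Ps d)"
    using i by (auto simp: support_def reed_muller_code_eq evaluation_def intro!: bexI[of _ f])
qed (auto simp: support_def reed_muller_code_def)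

theorem corollary5p7:
  fixes X :: "'k::field vec set set" and Ps :: "'k vec set list" and s d :: nat
  assumes "X \<subseteq> proj_space s" and "finite X" and "X \<noteq> {}"
    and "distinct Ps" and "set Ps = X"
    and "1 \<le> d"
  shows "rm_weight s Ps d (hilbert_function s X d) = card X"
proof -
  interpret vec_space "TYPE('k)" "length Ps" .
  let ?C = "reed_muller_code s Ps d"
  have C: "VectorSpace.subspace class_ring ?C V" by (rule subspace_reed_muller_code)
  have H: "hilbert_function s X d = vectorspace.dim class_ring (V\<lparr>carrier := ?C\<rparr>)"
    using hilbert_function_eq_dim_code assms(5) by blast
  \<comment> \<open>By \<open>subspace_eqI_dim\<close> only \<open>D = ?C\<close> qualifies, so the
    infimum is over a singleton.\<close>
  have "{card (support D) | D. VectorSpace.subspace class_ring D V \<and> D \<subseteq> ?C \<and>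
      vectorspace.dim class_ring (V\<lparr>carrier := D\<rparr>) = hilbert_function s X d} = {card (support ?C)}"
    using C subspace_eqI_dim[OF fin_dim _ C] unfolding H by blast
  then have "rm_weight s Ps d (hilbert_function s X d) = card (support ?C)"
    by (simp add: rm_weight_def gen_hamming_weight_def)
  also have "\<dots> = card X"
    \<comment> \<open>Since \<open>Ps\<close> lists \<open>X\<close> without repetition, the length
      of the code is \<open>card X\<close>.\<close>
    using support_reed_muller_code[of Ps s d] assms distinct_card[of Ps] by simp
  finally show ?thesis .
qed

end
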